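(* Let $u,v,t$ be integers with $t>1$ and $(u-1)(v-2)=2(2^{t-3}-1)$ (an equality of rational numbers). Then $(u,v,P,\mathbb{Q})$ is true if and only if $t\in\{3,4,5,7,15\}$.
   Context: For integers $u,v$, the phrase "$(u,v,P,\mathbb{Q})$ is true" means: there exist $a,b\in\mathbb{Q}$ with $a\neq 0$ such that the polynomial $P(x,y)=axy+bx+by+\frac{b^2-b}{a}\in\mathbb{Q}[x,y]$, which defines a commutative group operation $x\oplus y=P(x,y)$ on the set $\mathbb{Q}\setminus\{-b/a\}$, satisfies $1\oplus 1=u$ and $2\oplus 2=v$, i.e. $P(1,1)=u$ and $P(2,2)=v$. (The conditions are on the values of the polynomial; it is not required that $1$ and $2$ differ from $-b/a$.) *)

theory Defs
  imports Complex_Main "HOL-Algebra.Group"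
begin

definition polyP :: "rat \<Rightarrow> rat \<Rightarrow> rat \<Rightarrow> rat \<Rightarrow> rat" where
  "polyP a b x y = a * x * y + b * x + b * y + (b^2 - b) / a"

definition polyP_group :: "rat \<Rightarrow> rat \<Rightarrow> rat monoid" where
  "polyP_group a b =
     \<lparr>carrier = UNIV - {- b / a}, mult = polyP a b, one = (1 - b) / a\<rparr>"

text \<open>
  The phrase ``\<open>(u, v, P, \<rat>)\<close> is true''. The group condition holds for all \<open>a \<noteq> 0\<close>
  (lemma \<open>comm_group_polyP_group\<close> below), so it imposes no restriction. The two equations
  concern values of the polynomial only: neither 1 nor 2 is required to lie in the carrier.
\<close>

definition uvPQ_true :: "int \<Rightarrow> int \<Rightarrow> bool" where
  "uvPQ_true u v \<longleftrightarrow>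
     (\<exists>a b :: rat. a \<noteq> 0 \<and> comm_group (polyP_group a b) \<and>
        polyP a b 1 1 = of_int u \<and> polyP a b 2 2 = of_int v)"

text \<open>The map \<open>x \<mapsto> a x + b\<close> carries \<open>polyP a b\<close> to multiplication of nonzero rationals.\<close>

lemma polyP_affine:
  assumes "a \<noteq> 0"
  shows "a * polyP a b x y + b = (a * x + b) * (a * y + b)"
  using assms by (simp add: polyP_def field_simps power2_eq_square)

lemma comm_group_polyP_group:
  assumes a: "a \<noteq> 0"
  shows "comm_group (polyP_group a b)"
proof -
  have inj: "x = y" if "a * x + b = a * y + b" for x y
    using that a by simp
  have mem: "x \<noteq> - (b / a) \<longleftrightarrow> a * x + b \<noteq> 0" for x
    using a by (auto simp: field_simps add_eq_0_iff)
  have one: "a * ((1 - b) / a) + b = 1"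
    using a by simp
  show ?thesis
  proof (rule comm_groupI; unfold polyP_group_def; simp only: monoid.simps partial_object.simps)
    fix x y assume "x \<in> UNIV - {- b / a}" "y \<in> UNIV - {- b / a}"
    then show "polyP a b x y \<in> UNIV - {- b / a}"
      by (simp add: mem polyP_affine[OF a])
  next
    show "(1 - b) / a \<in> UNIV - {- b / a}"
      using one by (simp add: mem)
  next
    fix x y z
    show "polyP a b (polyP a b x y) z = polyP a b x (polyP a b y z)"
      by (rule inj) (simp only: polyP_affine[OF a] mult.assoc)
  next
    fix x y
    show "polyP a b x y = polyP a b y x"
      by (simp add: polyP_def algebra_simps)
  next
    fix x
    show "polyP a b ((1 - b) / a) x = x"
      by (rule inj) (simp only: polyP_affine[OF a] one mult_1)
  next
    fix x assume "x \<in> UNIV - {- b / a}"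
    then have nz: "a * x + b \<noteq> 0"
      by (simp add: mem)
    define y where "y = (1 / (a * x + b) - b) / a"
    have y: "a * y + b = 1 / (a * x + b)"
      using a by (simp add: y_def)
    have "polyP a b y x = (1 - b) / a"
      by (rule inj) (simp only: polyP_affine[OF a] one y, simp add: nz)
    moreover have "y \<in> UNIV - {- b / a}"
      using y nz by (simp add: mem)
    ultimately show "\<exists>y\<in>UNIV - {- b / a}. polyP a b y x = (1 - b) / a"
      by blast
  qed
qed

end

theory Submission
  imports Defs "HOL-Number_Theory.Cong"
begin

text \<open>
  Eliminating \<open>b\<close> from the two equations \<open>P(1,1) = u\<close> and \<open>P(2,2) = v\<close> leaves a monic quadratic
  equation for \<open>a\<close>, whose discriminant is four times \<open>4 (u - 1) (v - 2) + 1\<close>. Under the hypothesis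
  this number is \<open>2\<^sup>t - 7\<close>. It is nonzero, so the two roots are different and one of
  them is a legitimate \<open>a \<noteq> 0\<close> as soon as they are rational. Hence the claim says exactly that
  \<open>2\<^sup>t - 7\<close> is a square for \<open>t \<in> {3, 4, 5, 7, 15}\<close> only: the Ramanujan--Nagell theorem.

  That theorem is proved here by arithmetic in \<open>\<int>[\<alpha>]\<close> with \<open>\<alpha> = (1 + \<surd>-7) / 2\<close>, an element of norm 2,
  written out in integers. The powers are \<open>\<alpha>\<^sup>n = (V\<^sub>n + U\<^sub>n \<surd>-7) / 2\<close> for the two Lucas sequences
  \<open>U\<close> and \<open>V\<close> of parameters \<open>(1, 2)\<close>. A descent (lemma \<open>norm_power_of_2_descent\<close>), which divides
  by \<open>\<alpha>\<close> or its conjugate, takes the place of unique factorisation and shows that \<open>x\<^sup>2 + 7 = 2\<^sup>n\<close>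
  forces \<open>\<bar>U\<^sub>m\<bar> = 1\<close> for \<open>m = n - 2\<close>. For even \<open>n\<close> the equation is a difference of two squares equal to 7.
  For odd \<open>m \<ge> 3\<close> the sign is \<open>U\<^sub>m = -1\<close> by a congruence modulo 4. Finally \<open>U\<close> is injective on every
  residue class modulo 6 (lemma \<open>lucas_U_inj_mod_6\<close>): 7-adically, \<open>\<alpha>\<^sup>d\<close> is close to \<open>1 + d \<surd>-7\<close> when \<open>6\<close>
  divides \<open>d\<close>, so \<open>U\<^sub>m\<^sub>+\<^sub>d\<close> differs from \<open>U\<^sub>m\<close> by \<open>d V\<^sub>m\<close> up to a term divisible by a higher power of
  7. Since \<open>U\<close> takes the value \<open>-1\<close> at 3, 5 and 13, which represent the three odd classes
  modulo 6, these are the only odd indices of this kind.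
\<close>

section \<open>The Lucas sequences of the powers of \<open>(1 + \<surd>-7) / 2\<close>\<close>

fun lucas_U :: "nat \<Rightarrow> int" where
  "lucas_U 0 = 0"
| "lucas_U (Suc 0) = 1"
| "lucas_U (Suc (Suc n)) = lucas_U (Suc n) - 2 * lucas_U n"

fun lucas_V :: "nat \<Rightarrow> int" where
  "lucas_V 0 = 2"
| "lucas_V (Suc 0) = 1"
| "lucas_V (Suc (Suc n)) = lucas_V (Suc n) - 2 * lucas_V n"

text \<open>The next two lemmas are multiplication by \<open>\<alpha>\<close> and the law \<open>\<alpha>\<^sup>m\<^sup>+\<^sup>n = \<alpha>\<^sup>m \<alpha>\<^sup>n\<close>, in coordinates.\<close>

lemma lucas_Suc:
  "2 * lucas_U (Suc n) = lucas_V n + lucas_U n"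
  "2 * lucas_V (Suc n) = lucas_V n - 7 * lucas_U n"
  by (induction n rule: lucas_U.induct) auto

lemma lucas_add:
  "2 * lucas_U (m + n) = lucas_U m * lucas_V n + lucas_V m * lucas_U n
   \<and> 2 * lucas_V (m + n) = lucas_V m * lucas_V n - 7 * lucas_U m * lucas_U n"
proof (induction m)
  case 0
  then show ?case by simp
next
  case (Suc m)
  have "4 * lucas_U (Suc (m + n)) = 2 * lucas_V (m + n) + 2 * lucas_U (m + n)"
    "4 * lucas_V (Suc (m + n)) = 2 * lucas_V (m + n) - 7 * (2 * lucas_U (m + n))"
    using lucas_Suc[of "m + n"] by simp_all
  moreover have "2 * (lucas_U (Suc m) * lucas_V n + lucas_V (Suc m) * lucas_U n)
      = (lucas_V m + lucas_U m) * lucas_V n + (lucas_V m - 7 * lucas_U m) * lucas_U n"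
    using lucas_Suc[of m] by algebra
  moreover have "2 * (lucas_V (Suc m) * lucas_V n - 7 * lucas_U (Suc m) * lucas_U n)
      = (lucas_V m - 7 * lucas_U m) * lucas_V n - 7 * (lucas_V m + lucas_U m) * lucas_U n"
    using lucas_Suc[of m] by algebra
  ultimately show ?case
    using Suc.IH by (simp add: algebra_simps)
qed

lemma lucas_seventh:
  fixes d :: nat
  defines "A \<equiv> lucas_U d" and "B \<equiv> lucas_V d"
  shows "64 * lucas_U (7 * d) = 7 * B^6 * A - 245 * B^4 * A^3 + 1029 * B^2 * A^5 - 343 * A^7"
    and "64 * lucas_V (7 * d) = B^7 - 147 * B^5 * A^2 + 1715 * B^3 * A^4 - 2401 * B * A^6"
proof -
  have U2: "lucas_U (d + d) = A * B" and V2: "2 * lucas_V (d + d) = B^2 - 7 * A^2"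
    using lucas_add[of d d] by (simp_all add: A_def B_def power2_eq_square)
  have U3: "4 * lucas_U (d + d + d) = 3 * B^2 * A - 7 * A^3"
    and V3: "4 * lucas_V (d + d + d) = B^3 - 21 * B * A^2"
    using lucas_add[of "d + d" d] U2 V2 unfolding A_def[symmetric] B_def[symmetric] by algebra+
  let ?e = "d + d + d"
  have U6: "16 * lucas_U (?e + ?e) = (3 * B^2 * A - 7 * A^3) * (B^3 - 21 * B * A^2)"
    and V6: "32 * lucas_V (?e + ?e) = (B^3 - 21 * B * A^2)^2 - 7 * (3 * B^2 * A - 7 * A^3)^2"
    using lucas_add[of ?e ?e] U3 V3 by algebra+
  have 7: "7 * d = ?e + ?e + d" by simp
  show "64 * lucas_U (7 * d) = 7 * B^6 * A - 245 * B^4 * A^3 + 1029 * B^2 * A^5 - 343 * A^7"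
    and "64 * lucas_V (7 * d) = B^7 - 147 * B^5 * A^2 + 1715 * B^3 * A^4 - 2401 * B * A^6"
    using lucas_add[of "?e + ?e" d] U6 V6 unfolding 7 A_def[symmetric] B_def[symmetric] by algebra+
qed

text \<open>The sign of a value \<open>\<plusminus>1\<close> of \<open>U\<close> is read off from this congruence.\<close>

lemma lucas_U_mod_4:
  "n \<ge> 2 \<Longrightarrow> lucas_U n mod 4 = (if even n then 1 else 3)"
proof (induction n rule: lucas_U.induct)
  case (3 n)
  have odd: "odd (lucas_U n)" if "n \<noteq> 0"
  proof (cases "n = 1")
    case False
    with that have "lucas_U n mod 4 = (if even n then 1 else 3)" using 3 by simp
    then show ?thesis by (cases "even n"; simp) presburger+
  qed simp
  show ?case
  proof (cases "n = 0")
    case False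
    show ?thesis
    proof (cases "n = 1")
      case False
      then have "lucas_U (Suc n) mod 4 = (if even n then 3 else 1)"
        using 3 \<open>n \<noteq> 0\<close> by simp
      with odd[OF \<open>n \<noteq> 0\<close>] show ?thesis
        by (cases "even n"; simp) presburger+
    qed simp
  qed simp
qed auto

lemma odd_lucas_U: "n \<ge> 1 \<Longrightarrow> odd (lucas_U n)"
proof (cases "n = 1")
  case False
  assume "n \<ge> 1"
  with False have "lucas_U n mod 4 = (if even n then 1 else 3)"
    by (intro lucas_U_mod_4) simp
  then show ?thesis by (cases "even n"; simp) presburger+
qed simp

section \<open>Injectivity on residue classes modulo 6\<close>

text \<open>Modulo 7, \<open>\<alpha>\<^sup>n = 2\<^sup>-\<^sup>n (1 + \<surd>-7)\<^sup>n\<close> is \<open>4\<^sup>n (1 + n \<surd>-7)\<close>.\<close>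

lemma lucas_mod_7:
  "[lucas_V n = 2 * 4 ^ n] (mod 7)" "[lucas_U n = 2 * int n * 4 ^ n] (mod 7)"
proof (induction n)
  case (Suc n)
  {
    case 1
    have "[4 * (2 * lucas_V (Suc n)) = 4 * (2 * 4 ^ n - 7 * lucas_U n)] (mod 7)"
      unfolding lucas_Suc by (intro cong_mult cong_diff cong_refl Suc)
    then obtain k where "4 * (2 * lucas_V (Suc n)) - 4 * (2 * 4 ^ n - 7 * lucas_U n) = 7 * k"
      by (auto simp: cong_iff_dvd_diff)
    then have "lucas_V (Suc n) - 2 * 4 ^ Suc n = 7 * (k - lucas_V (Suc n) - 4 * lucas_U n)"
      by simp
    then show ?case by (metis cong_iff_dvd_diff dvd_triv_left)
  next
    case 2
    have "[4 * (2 * lucas_U (Suc n)) = 4 * (2 * 4 ^ n + 2 * int n * 4 ^ n)] (mod 7)"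
      unfolding lucas_Suc by (intro cong_mult cong_add cong_refl Suc)
    then obtain k where "4 * (2 * lucas_U (Suc n)) - 4 * (2 * 4 ^ n + 2 * int n * 4 ^ n) = 7 * k"
      by (auto simp: cong_iff_dvd_diff)
    then have "lucas_U (Suc n) - 2 * int (Suc n) * 4 ^ Suc n = 7 * (k - lucas_U (Suc n))"
      by (simp add: algebra_simps)
    then show ?case by (metis cong_iff_dvd_diff dvd_triv_left)
  }
qed simp_all

lemma not_7_dvd_lucas_V: "\<not> 7 dvd lucas_V n"
proof
  assume "7 dvd lucas_V n"
  then have "7 dvd (2 * 4 ^ n :: int)"
    using lucas_mod_7(1)[of n] cong_dvd_iff by blast
  also have "(2 * 4 ^ n :: int) = 2 ^ (2 * n + 1)"
    by (simp add: power_mult)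
  finally have "7 dvd (2 :: int)"
    by (rule prime_dvd_power[rotated]) simp
  then show False by simp
qed

text \<open>
  The 7-adic estimate \<open>\<alpha>\<^sup>d \<equiv> 1 + d \<surd>-7\<close>, modulo one more power of 7 than \<open>d\<close> is known to contain.
  Passing from \<open>d\<close> to \<open>7 d\<close> raises \<open>\<alpha>\<^sup>d = (B + A \<surd>-7) / 2\<close> to the seventh power. The
  congruence \<open>B \<equiv> 2\<close> gains a factor 7 in \<open>B\<^sup>7 \<equiv> 2\<^sup>7\<close>, and so does \<open>A \<equiv> 2 d\<close> in the linear term
  \<open>7 B\<^sup>6 A\<close>. As \<open>A\<close> contains the known power of 7, the terms of higher degree in \<open>A\<close>
  vanish to the new precision.
\<close>

lemma lucas_7_adic:
  "[lucas_V (6 * 7 ^ l * k) = 2] (mod 7 ^ (l + 1))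
   \<and> [lucas_U (6 * 7 ^ l * k) = 2 * int (6 * 7 ^ l * k)] (mod 7 ^ (l + 1))"
proof (induction l)
  case 0
  have "[(4 ^ 6) ^ k = (1 :: int) ^ k] (mod 7)"
    by (intro cong_pow) (simp add: cong_def)
  then have 4: "[4 ^ (6 * k) = (1 :: int)] (mod 7)"
    by (simp add: power_mult)
  have "[2 * 4 ^ (6 * k) = (2 * 1 :: int)] (mod 7)"
    "[2 * int (6 * k) * 4 ^ (6 * k) = 2 * int (6 * k) * 1] (mod 7)"
    by (intro cong_mult 4 cong_refl)+
  with lucas_mod_7[of "6 * k"] show ?case
    by (auto intro: cong_trans)
next
  case (Suc l)
  define d where "d = 6 * 7 ^ l * k"
  define q where "q = (7 :: int) ^ l"
  define c where "c = 6 * int k"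
  have dq: "int d = q * c" by (simp add: d_def q_def c_def)
  obtain p where V: "lucas_V d = 2 + 7 * q * p"
    using Suc.IH unfolding d_def[symmetric] q_def
    by (auto simp: cong_iff_dvd_diff dvd_def algebra_simps)
  obtain r where U: "lucas_U d = q * (2 * c + 7 * r)"
    using Suc.IH unfolding d_def[symmetric] dq q_def
    by (auto simp: cong_iff_dvd_diff dvd_def algebra_simps)
  define s where "s = 2 * c + 7 * r"
  have e: "6 * 7 ^ Suc l * k = 7 * d" by (simp add: d_def)
  have coprime: "coprime (64 :: int) (49 * q)"
  proof -
    have "coprime ((2 :: int) ^ 6) (7 ^ (l + 2))"
      by (intro coprime_power_left_iff[THEN iffD2] coprime_power_right_iff[THEN iffD2] disjI1) simp
    then show ?thesis by (simp add: q_def)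
  qed
  let ?B = "lucas_V d" and ?A = "lucas_U d"
  have A: "?A = q * s" by (simp add: U s_def)
  have B: "[?B = 2] (mod 7)" by (simp add: V cong_iff_dvd_diff)
  then have "[?B^6 = 2^6] (mod 7)" by (rule cong_pow)
  then obtain w\<^sub>6 where "?B^6 - 64 = 7 * w\<^sub>6" by (auto simp: cong_iff_dvd_diff)
  then have B6: "?B^6 = 64 + 7 * w\<^sub>6" by simp
  (* The cofactor of B - 2 in B^7 - 2^7 is a sum of seven terms congruent to 2^6. *)
  let ?S = "?B^6 + ?B^5 * 2 + ?B^4 * 2^2 + ?B^3 * 2^3 + ?B^2 * 2^4 + ?B * 2^5 + 2^6"
  have "[?S = 2^6 + 2^5 * 2 + 2^4 * 2^2 + 2^3 * 2^3 + 2^2 * 2^4 + 2 * 2^5 + 2^6] (mod 7)"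
    by (intro cong_add cong_mult cong_pow cong_refl B)
  then have "[?S = 0] (mod 7)" by (rule cong_trans) (simp add: cong_def)
  then obtain r' where "?S = 7 * r'" by (auto simp: cong_0_iff)
  moreover have "?B^7 - 128 = (?B - 2) * ?S"
    by (simp add: eval_nat_numeral algebra_simps)
  ultimately have "?B^7 = 128 + 49 * q * (p * r')" by (simp add: V)
  then obtain w\<^sub>7 where B7: "?B^7 = 128 + 49 * q * w\<^sub>7" by blast
  have "64 * (lucas_V (7 * d) - 2)
      = 49 * q * (w\<^sub>7 - 3 * ?B^5 * q * s^2 + 35 * ?B^3 * q^3 * s^4 - 49 * ?B * q^5 * s^6)"
    unfolding right_diff_distrib lucas_seventh(2) A B7 by algebra
  then have "49 * q dvd lucas_V (7 * d) - 2"
    using coprime by (metis coprime_commute coprime_dvd_mult_right_iff dvd_triv_left)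
  moreover have "64 * (lucas_U (7 * d) - 14 * (q * c))
      = 49 * q * (64 * r + s * w\<^sub>6 - 5 * ?B^4 * q^2 * s^3 + 21 * ?B^2 * q^4 * s^5 - 7 * q^6 * s^7)"
    unfolding right_diff_distrib lucas_seventh(1) A B6 unfolding s_def by algebra
  then have "49 * q dvd lucas_U (7 * d) - 14 * (q * c)"
    using coprime by (metis coprime_commute coprime_dvd_mult_right_iff dvd_triv_left)
  moreover have "2 * int (7 * d) = 14 * (q * c)" by (simp add: dq)
  ultimately show ?case
    unfolding e by (simp add: cong_iff_dvd_diff q_def dq algebra_simps)
qed

text \<open>
  If \<open>U\<^sub>m\<^sub>+\<^sub>d = U\<^sub>m\<close>, then \<open>d V\<^sub>m\<close> is divisible by one more power of 7 than \<open>d\<close> is known to be, and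
  \<open>V\<^sub>m\<close> is prime to 7. So \<open>d\<close> is divisible by every power of 7.
\<close>

lemma lucas_U_period_zero:
  assumes eq: "lucas_U (m + d) = lucas_U m" and "6 dvd d"
  shows "d = 0"
proof -
  have pow: "7 ^ l dvd d" for l
  proof (induction l)
    case (Suc l)
    have "coprime (6 :: nat) (7 ^ l)"
      by (intro coprime_power_right_iff[THEN iffD2] disjI1) (simp add: coprime_iff_gcd_eq_1 gcd_non_0_nat)
    then have "6 * 7 ^ l dvd d"
      using \<open>6 dvd d\<close> Suc by (simp add: divides_mult)
    then obtain k where "d = 6 * 7 ^ l * k" by (auto elim: dvdE)
    then have V: "[lucas_V d = 2] (mod 7 ^ (l + 1))"
      and U: "[lucas_U d = 2 * int d] (mod 7 ^ (l + 1))"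
      using lucas_7_adic[of l k] by simp_all
    have "[lucas_U m * lucas_V d + lucas_V m * lucas_U d
        = lucas_U m * 2 + lucas_V m * (2 * int d)] (mod 7 ^ (l + 1))"
      by (intro cong_add cong_mult cong_refl U V)
    then have "[2 * lucas_U m = lucas_U m * 2 + lucas_V m * (2 * int d)] (mod 7 ^ (l + 1))"
      using lucas_add[of m d] eq by simp
    then have "7 ^ (l + 1) dvd 2 * lucas_V m * int d"
      by (simp add: cong_iff_dvd_diff algebra_simps)
    moreover have "coprime (7 ^ (l + 1)) (2 * lucas_V m)"
      using not_7_dvd_lucas_V[of m]
      by (auto intro!: prime_imp_coprime simp: coprime_power_left_iff prime_dvd_mult_iff)
    ultimately have "7 ^ (l + 1) dvd int d"
      using coprime_dvd_mult_right_iff by blast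
    then have "int (7 ^ (l + 1)) dvd int d" by simp
    then show ?case by (simp only: int_dvd_int_iff) simp
  qed simp
  show ?thesis
  proof (rule ccontr)
    assume "d \<noteq> 0"
    then have "7 ^ d \<le> d" using pow[of d] by (simp add: dvd_imp_le)
    moreover have "d < 7 ^ d" by (rule power_gt_expt) simp
    ultimately show False by simp
  qed
qed

lemma lucas_U_inj_mod_6:
  assumes "lucas_U m = lucas_U n" and "[m = n] (mod 6)"
  shows "m = n"
proof (cases "m \<le> n")
  case True
  with assms(2) have "6 dvd n - m"
    by (metis cong_def mod_eq_dvd_iff_nat)
  with True assms(1) show ?thesis
    using lucas_U_period_zero[of m "n - m"] by simp
next
  case False
  with assms(2) have "6 dvd m - n"
    by (metis cong_def mod_eq_dvd_iff_nat nat_le_linear)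
  with False assms(1) show ?thesis
    using lucas_U_period_zero[of n "m - n"] by simp
qed

lemma lucas_U_eq_minus_1:
  assumes "odd m" and "lucas_U m = -1"
  shows "m \<in> {3, 5, 13}"
proof -
  have "lucas_U 3 = -1" "lucas_U 5 = -1" "lucas_U 13 = -1"
    by (simp_all add: eval_nat_numeral)
  moreover have "m mod 6 = 1 \<or> m mod 6 = 3 \<or> m mod 6 = 5"
    using \<open>odd m\<close> by presburger
  then have "[m = 13] (mod 6) \<or> [m = 3] (mod 6) \<or> [m = 5] (mod 6)"
    by (simp add: cong_def)
  ultimately have "m = 13 \<or> m = 3 \<or> m = 5"
    using assms(2) lucas_U_inj_mod_6[of m 13] lucas_U_inj_mod_6[of m 3] lucas_U_inj_mod_6[of m 5]
    by presburger
  then show ?thesis by blast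
qed

section \<open>The Ramanujan--Nagell theorem\<close>

text \<open>
  The number \<open>(x + y \<surd>-7) / 2\<close> has norm \<open>2\<^sup>m\<close> and is divisible by exactly one of \<open>\<alpha>\<close> and its conjugate,
  according to the residue of \<open>x y\<close> modulo 4. After conjugation it is \<open>\<alpha>\<close>, and the quotient
  \<open>((2 y - z) + z \<surd>-7) / 2\<close> with \<open>4 z = y - x\<close> satisfies the same hypotheses for \<open>m - 1\<close> if \<open>m > 1\<close>.
\<close>

lemma norm_power_of_2_descent:
  fixes x y :: int
  assumes "m \<ge> 1" "odd x" "odd y" "x^2 + 7 * y^2 = 2 ^ (m + 2)"
  shows "\<bar>x\<bar> = \<bar>lucas_V m\<bar> \<and> \<bar>y\<bar> = \<bar>lucas_U m\<bar>"
  using assms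
proof (induction m arbitrary: x y rule: nat_induct_at_least)
  case base
  have "y^2 \<ge> 1" "x^2 \<ge> 1"
    using base by (auto simp: int_one_le_iff_zero_less)
  with base have "y^2 = 1" "x^2 = 1" by simp_all
  then show ?case by (simp add: power2_eq_1_iff) auto
next
  case (Suc k)
  have main: "\<bar>x\<bar> = \<bar>lucas_V (Suc k)\<bar> \<and> \<bar>y\<bar> = \<bar>lucas_U (Suc k)\<bar>"
    if "odd x" "odd y" "x^2 + 7 * y^2 = 2 ^ (Suc k + 2)" "4 dvd y - x" for x y
  proof -
    obtain z where x: "x = y - 4 * z" using \<open>4 dvd y - x\<close> by (auto simp: dvd_def algebra_simps)
    have eq: "y^2 - y * z + 2 * z^2 = 2 ^ k"
      using that(3) unfolding x by (simp add: power2_eq_square algebra_simps)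
    then have "even (y^2 - y * z + 2 * z^2)" using \<open>k \<ge> 1\<close> by simp
    then have "odd z" using \<open>odd y\<close> by simp
    have "(2 * y - z)^2 + 7 * z^2 = 2 ^ (k + 2)"
      using eq by (simp add: power2_eq_square algebra_simps)
    with Suc.IH[of "2 * y - z" z] \<open>odd z\<close>
    have IH: "\<bar>2 * y - z\<bar> = \<bar>lucas_V k\<bar>" "\<bar>z\<bar> = \<bar>lucas_U k\<bar>" by auto
    have "odd (lucas_U k)" "odd (lucas_U (Suc k))"
      using \<open>k \<ge> 1\<close> by (simp_all add: odd_lucas_U)
    have U: "lucas_V k = 2 * lucas_U (Suc k) - lucas_U k"
      and V: "lucas_V k - 7 * lucas_U k = 2 * lucas_V (Suc k)"
      using lucas_Suc[of k] by simp_all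
    (* The signs of 2 y - z and z agree with those of V and U up to a common factor: otherwise y
       would be plus or minus the difference of two consecutive odd terms of U, hence even. *)
    have "2 * y - z = lucas_V k \<and> z = lucas_U k \<or> 2 * y - z = - lucas_V k \<and> z = - lucas_U k"
    proof (rule ccontr)
      assume "\<not> ?thesis"
      with IH have "2 * y - z = lucas_V k \<and> z = - lucas_U k \<or> 2 * y - z = - lucas_V k \<and> z = lucas_U k"
        by (auto simp: abs_eq_iff)
      then have "y = lucas_U (Suc k) - lucas_U k \<or> y = lucas_U k - lucas_U (Suc k)"
        using U by auto
      then have "even y"
        using \<open>odd (lucas_U k)\<close> \<open>odd (lucas_U (Suc k))\<close> by auto
      with \<open>odd y\<close> show False ..
    qed
    then have "y = lucas_U (Suc k) \<and> x = lucas_V (Suc k) \<or> y = - lucas_U (Suc k) \<and> x = - lucas_V (Suc k)"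
      using U V unfolding x by auto
    then show ?thesis by auto
  qed
  have "4 dvd y - x \<or> 4 dvd y - (-x)"
    using \<open>odd x\<close> \<open>odd y\<close> by presburger
  then show ?case
    using main[of x y] main[of "-x" y] Suc.prems by auto
qed

theorem ramanujan_nagell:
  fixes x :: int
  assumes "x^2 + 7 = 2 ^ n"
  shows "n \<in> {3, 4, 5, 7, 15}"
proof -
  have "n \<ge> 3"
  proof (rule ccontr)
    assume "\<not> n \<ge> 3"
    then have "(2 :: int) ^ n \<le> 2 ^ 2" by (intro power_increasing) auto
    with assms show False using zero_le_power2[of x] by simp
  qed
  define m where "m = n - 2"
  have m: "m \<ge> 1" "n = m + 2" using \<open>n \<ge> 3\<close> by (simp_all add: m_def)
  have "even (x^2 + 7)" unfolding assms using \<open>n \<ge> 3\<close> by simp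
  then have "odd x" by simp
  have U: "\<bar>lucas_U m\<bar> = 1"
    using norm_power_of_2_descent[of m x 1] assms m \<open>odd x\<close> by simp
  show ?thesis
  proof (cases "even n")
    case True
    then obtain k where k: "n = 2 * k" by (auto elim: evenE)
    define y :: int where "y = 2 ^ k"
    have y: "\<bar>x\<bar>^2 + 7 = y^2" "y > 0"
      using assms by (simp_all add: y_def k power_mult mult.commute[of 2])
    then have "\<bar>x\<bar> < y" using power2_less_imp_less[of "\<bar>x\<bar>" y] by simp
    then have "(\<bar>x\<bar> + 1)^2 \<le> y^2" by (intro power_mono) auto
    with y have "\<bar>x\<bar> \<le> 3" by (simp add: power2_eq_square algebra_simps)
    then have "\<bar>x\<bar>^2 \<le> 3^2" by (intro power_mono) auto
    with assms have "(2 :: int) ^ n \<le> 2 ^ 4" by simp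
    then have "n \<le> 4" by (subst (asm) power_increasing_iff) auto
    with \<open>n \<ge> 3\<close> True have "n = 4" by presburger
    then show ?thesis by simp
  next
    case False
    show ?thesis
    proof (cases "m = 1")
      case False
      have "lucas_U m mod 4 = 3"
        using lucas_U_mod_4[of m] False m \<open>odd n\<close> by simp
      with U have "lucas_U m = -1" by (auto simp: abs_if split: if_splits)
      then show ?thesis
        using lucas_U_eq_minus_1[of m] m \<open>odd n\<close> by auto
    qed (simp add: m)
  qed
qed

section \<open>The quadratic equation for the coefficients of the group law\<close>

lemma rat_square_eq_of_int:
  fixes r :: rat
  assumes "r^2 = of_int N"
  obtains x :: int where "x^2 = N"
proof -
  obtain p q where r: "r = Fract p q" "q > 0" "coprime p q" by (cases r) auto
  then have "r * of_int q = of_int p" by (simp add: Fract_of_int_quotient)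
  then have "(of_int p)^2 = r^2 * (of_int q)^2" by (metis power_mult_distrib)
  then have "of_int (p^2) = (of_int (N * q^2) :: rat)" using assms by simp
  then have "p^2 = N * q^2" by (simp only: of_int_eq_iff)
  then have "q^2 dvd p^2" by simp
  then have "q dvd p" by (simp add: pow_divides_pow_iff)
  with r have "q = 1" by (metis coprime_common_divisor dvd_refl zdvd1_eq abs_of_pos)
  with \<open>p^2 = N * q^2\<close> that[of p] show thesis by simp
qed

text \<open>
  The difference of the two equations is \<open>3 a + 2 b = v - u\<close>. Inserting this into either of them
  gives \<open>(a - (u - 1) - (v - 2))\<^sup>2 = 4 (u - 1) (v - 2) + 1\<close>.
\<close>

lemma uvPQ_true_iff_square:
  assumes "4 * (u - 1) * (v - 2) + 1 \<noteq> 0"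
  shows "uvPQ_true u v \<longleftrightarrow> (\<exists>x. x^2 = 4 * (u - 1) * (v - 2) + 1)"
proof
  assume "uvPQ_true u v"
  then obtain a b :: rat where a: "a \<noteq> 0" and "polyP a b 1 1 = of_int u" "polyP a b 2 2 = of_int v"
    by (auto simp: uvPQ_true_def)
  then have 1: "a^2 + 2 * a * b + b^2 - b = a * of_int u"
    and 2: "4 * a^2 + 4 * a * b + b^2 - b = a * of_int v"
    by (simp_all add: polyP_def field_simps power2_eq_square)
  then have "a * (3 * a + 2 * b) = a * (of_int v - of_int u)"
    by (simp add: power2_eq_square algebra_simps)
  with a have 3: "3 * a + 2 * b = of_int v - of_int u" by simp
  have "(a - (of_int u - 1) - (of_int v - 2))^2 = 4 * (of_int u - 1) * (of_int v - 2) + 1"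
    using 1 3 by algebra
  then have "(a - (of_int u - 1) - (of_int v - 2))^2 = of_int (4 * (u - 1) * (v - 2) + 1)"
    by simp
  then show "\<exists>x. x^2 = 4 * (u - 1) * (v - 2) + 1"
    using rat_square_eq_of_int by metis
next
  assume "\<exists>x. x^2 = 4 * (u - 1) * (v - 2) + 1"
  then obtain x where x: "x^2 = 4 * (u - 1) * (v - 2) + 1" by blast
  with assms have "x \<noteq> 0" by auto
  (* With s = (u - 1) + (v - 2), the roots s + x and s - x differ, so one of them is nonzero. *)
  obtain y where y: "y^2 = 4 * (u - 1) * (v - 2) + 1" "(u - 1) + (v - 2) + y \<noteq> 0"
  proof (cases "(u - 1) + (v - 2) + x = 0")
    case True
    with \<open>x \<noteq> 0\<close> x that[of "-x"] show thesis by simp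
  qed (use x that in blast)
  define a b :: rat where "a = of_int ((u - 1) + (v - 2) + y)"
    and "b = (of_int v - of_int u - 3 * a) / 2"
  have "a \<noteq> 0" using y(2) unfolding a_def by simp
  have "of_int (y^2) = (of_int (4 * (u - 1) * (v - 2) + 1) :: rat)" using y(1) by simp
  then have q: "(of_int y :: rat)^2 = 4 * (of_int u - 1) * (of_int v - 2) + 1" by simp
  have a: "a = of_int u - 1 + (of_int v - 2) + of_int y" by (simp add: a_def)
  have b: "2 * b = of_int v - of_int u - 3 * a" by (simp add: b_def)
  have "4 * (a^2 + 2 * a * b + b^2 - b) = 4 * (a * of_int u)"
    "4 * (4 * a^2 + 4 * a * b + b^2 - b) = 4 * (a * of_int v)"
    using q a b by algebra+
  then have "polyP a b 1 1 = of_int u" "polyP a b 2 2 = of_int v"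
    using \<open>a \<noteq> 0\<close> by (simp_all add: polyP_def field_simps power2_eq_square)
  then show "uvPQ_true u v"
    using \<open>a \<noteq> 0\<close> comm_group_polyP_group unfolding uvPQ_true_def by blast
qed

theorem theorem5:
  fixes u v t :: int
  assumes "t > 1"
    and "(of_int ((u - 1) * (v - 2)) :: rat) = 2 * (2 powi (t - 3) - 1)"
  shows "uvPQ_true u v \<longleftrightarrow> t \<in> {3, 4, 5, 7, 15}"
proof -
  define n where "n = nat t"
  have t: "t = int n" "n \<ge> 2" using assms(1) by (simp_all add: n_def)
  have "(2 :: rat) powi (t - 3) * 8 = 2 ^ n"
    by (simp add: power_int_diff t)
  then have "(of_int (4 * (u - 1) * (v - 2) + 1) :: rat) = of_int (2 ^ n - 7)"
    using assms(2) by (simp add: algebra_simps)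
  then have D: "4 * (u - 1) * (v - 2) + 1 = 2 ^ n - 7"
    by (simp only: of_int_eq_iff)
  moreover have "odd (4 * (u - 1) * (v - 2) + 1)" by simp
  then have "4 * (u - 1) * (v - 2) + 1 \<noteq> 0" by (metis even_zero)
  ultimately have "uvPQ_true u v \<longleftrightarrow> (\<exists>x :: int. x^2 = 2 ^ n - 7)"
    using uvPQ_true_iff_square by metis
  also have "\<dots> \<longleftrightarrow> n \<in> {3, 4, 5, 7, 15}"
  proof
    assume "\<exists>x :: int. x^2 = 2 ^ n - 7"
    then show "n \<in> {3, 4, 5, 7, 15}" using ramanujan_nagell by (metis diff_add_cancel)
  next
    have "(1 :: int)^2 = 2 ^ 3 - 7" "(3 :: int)^2 = 2 ^ 4 - 7" "(5 :: int)^2 = 2 ^ 5 - 7"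
      "(11 :: int)^2 = 2 ^ 7 - 7" "(181 :: int)^2 = 2 ^ 15 - 7"
      by simp_all
    moreover assume "n \<in> {3, 4, 5, 7, 15}"
    ultimately show "\<exists>x :: int. x^2 = 2 ^ n - 7" by blast
  qed
  also have "\<dots> \<longleftrightarrow> t \<in> {3, 4, 5, 7, 15}" by (auto simp: t)
  finally show ?thesis .
qed

end
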